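(* Let $(A_Q)_{Q\in\mathcal D(Q_0)}$ be a sequence of positive semidefinite matrices. The Carleson condition $$\frac{1}{|K|}\sum_{Q\in\mathcal D(K)}A_Q\lesssim\mathbf 1,\qquad\forall K\in\mathcal D(Q_0),$$ does not imply the existence of a constant so that $$\sum_{Q\in\mathcal D(Q_0)}\bigl|\bigl\langle A_Q\langle W\rangle_Q^{-1}\langle W^{1/2}f\rangle_Q,\ \langle W^{-1}\rangle_Q^{-1}\langle W^{-1/2}g\rangle_Q\bigr\rangle_{\mathbb C^d}\bigr|\lesssim\|f\|_{L^2_{\mathbb C^d}}\|g\|_{L^2_{\mathbb C^d}}$$ for all matrix weights $W$ and functions $f,g$ supported in $Q_0$. The Carleson condition also does not imply $$\sum_{Q\in\mathcal D(Q_0)}\bigl\|A_Q^{1/2}\langle W\rangle_Q^{-1}\langle W^{1/2}f\rangle_Q\bigr\|_{\mathbb C^d}\,\bigl\|A_Q^{1/2}\langle W^{-1}\rangle_Q^{-1}\langle W^{-1/2}g\rangle_Q\bigr\|_{\mathbb C^d}\lesssim\|f\|_{L^2_{\mathbb C^d}}\|g\|_{L^2_{\mathbb C^d}}$$ for all matrix weights $W$ and functions $f,g$ supported in $Q_0$, not even if we only allow scalar sequences $A_Q=m_Q$.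
   Context: $Q_0=[0,1]$ carries its dyadic filtration. For a dyadic interval $K\subseteq Q_0$, $\mathcal D(K)$ denotes the collection of all dyadic subintervals of $K$ (including $K$ itself), and $|K|$ is the Lebesgue measure of $K$. All matrices are of size $d\times d$, where the size $d$ is not fixed in the statement: what is asserted is that the implications, as general statements about matrix weights and matrix sequences, do not hold. A matrix weight is a $d\times d$ matrix-valued function $W$ such that $W(x)$ is positive semidefinite for almost every $x$ and both $W$ and $W^{-1}$ are locally integrable. For a scalar-, vector- or matrix-valued function $h$, $\langle h\rangle_Q=\frac1{|Q|}\int_Q h\,dx$ is its average over $Q$. $L^2_{\mathbb C^d}$ is the unweighted space of functions $f:Q_0\to\mathbb C^d$ with $\|f\|_{L^2_{\mathbb C^d}}^2=\int_{Q_0}\|f(x)\|_{\mathbb C^d}^2\,dx<\infty$. $\mathbf 1$ is the identity matrix, $\langle\cdot,\cdot\rangle_{\mathbb C^d}$ is the standard inner product, and matrix inequalities are understood in the sense of operators (positive semidefinite order). A scalar sequence $A_Q=m_Q$ means that $A_Q$ is the non-negative scalar $m_Q$ times the identity matrix. The symbol $\lesssim$ means inequality up to a finite multiplicative constant; in the Carleson condition the constant is independent of $K$, and in the two bilinear inequalities it is independent of $W$, $f$ and $g$. *)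

theory Defs
  imports "HOL-Analysis.Analysis" "Jordan_Normal_Form.Gauss_Jordan_Elimination"
begin

text \<open>The size \<open>d\<close> of the matrices varies inside the statement, so vectors and matrices are
  those of \<open>Jordan_Normal_Form\<close>. Their names are qualified where they clash with
  \<open>HOL-Analysis\<close>.\<close>

definition dyadic :: "real set \<Rightarrow> real set set" where
  "dyadic K = {Q. Q \<subseteq> K \<and>
     (\<exists>n k :: nat. k < 2 ^ n \<and> Q = {real k / 2 ^ n .. real (Suc k) / 2 ^ n})}"

text \<open>The order on \<^typ>\<open>complex\<close> is that of \<open>Complex_Order\<close>: \<open>0 \<le> z\<close> says that \<open>z\<close> is real and
  nonnegative. Over the complex numbers this forces \<open>A\<close> to be Hermitian.\<close>

definition psd :: "nat \<Rightarrow> complex Matrix.mat \<Rightarrow> bool" where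
  "psd d A \<longleftrightarrow> A \<in> carrier_mat d d \<and> (\<forall>v \<in> carrier_vec d. 0 \<le> (A *\<^sub>v v) \<bullet>c v)"

definition mat_le :: "nat \<Rightarrow> complex Matrix.mat \<Rightarrow> complex Matrix.mat \<Rightarrow> bool" where
  "mat_le d A B \<longleftrightarrow> A \<in> carrier_mat d d \<and> B \<in> carrier_mat d d \<and> psd d (B - A)"

definition psd_sqrt :: "nat \<Rightarrow> complex Matrix.mat \<Rightarrow> complex Matrix.mat" where
  "psd_sqrt d A = (THE B. psd d B \<and> B * B = A)"

text \<open>Unspecified on singular matrices.\<close>

definition mat_inv :: "complex Matrix.mat \<Rightarrow> complex Matrix.mat" where
  "mat_inv A = the (mat_inverse A)"

definition cnorm :: "complex Matrix.vec \<Rightarrow> real" where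
  "cnorm v = sqrt (Re (v \<bullet>c v))"

definition avg_mat :: "nat \<Rightarrow> real set \<Rightarrow> (real \<Rightarrow> complex Matrix.mat) \<Rightarrow> complex Matrix.mat" where
  "avg_mat d Q M = Matrix.mat d d
     (\<lambda>ij. (1 / measure lebesgue Q) *\<^sub>R (LINT x | lebesgue_on Q. M x $$ ij))"

definition avg_vec :: "nat \<Rightarrow> real set \<Rightarrow> (real \<Rightarrow> complex Matrix.vec) \<Rightarrow> complex Matrix.vec" where
  "avg_vec d Q h = Matrix.vec d
     (\<lambda>i. (1 / measure lebesgue Q) *\<^sub>R (LINT x | lebesgue_on Q. vec_index (h x) i))"

text \<open>Integrability on the compact interval \<open>{0..1}\<close> is local integrability on it. The existence
  of \<open>W(x)\<^sup>-\<^sup>1\<close> for almost every \<open>x\<close> is stated explicitly.\<close>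

definition matrix_weight :: "nat \<Rightarrow> (real \<Rightarrow> complex Matrix.mat) \<Rightarrow> bool" where
  "matrix_weight d W \<longleftrightarrow>
     (AE x in lebesgue_on {0..1}. psd d (W x) \<and> invertible_mat (W x)) \<and>
     (\<forall>i<d. \<forall>j<d. integrable (lebesgue_on {0..1}) (\<lambda>x. W x $$ (i, j)) \<and>
                  integrable (lebesgue_on {0..1}) (\<lambda>x. mat_inv (W x) $$ (i, j)))"

definition L2 :: "nat \<Rightarrow> (real \<Rightarrow> complex Matrix.vec) set" where
  "L2 d = {f. (\<forall>x \<in> {0..1}. f x \<in> carrier_vec d) \<and>
     (\<forall>i<d. (\<lambda>x. vec_index (f x) i) \<in> borel_measurable (lebesgue_on {0..1})) \<and>
     integrable (lebesgue_on {0..1}) (\<lambda>x. (cnorm (f x))\<^sup>2)}"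

definition L2_norm :: "(real \<Rightarrow> complex Matrix.vec) \<Rightarrow> real" where
  "L2_norm f = sqrt (LINT x | lebesgue_on {0..1}. (cnorm (f x))\<^sup>2)"

definition psd_sequence :: "nat \<Rightarrow> (real set \<Rightarrow> complex Matrix.mat) \<Rightarrow> bool" where
  "psd_sequence d A \<longleftrightarrow> (\<forall>Q \<in> dyadic {0..1}. psd d (A Q))"

text \<open>The matrix series is summed entrywise; its convergence is part of the condition, because
  \<^const>\<open>infsum\<close> is \<open>0\<close> for a divergent family.\<close>

definition carleson :: "nat \<Rightarrow> (real set \<Rightarrow> complex Matrix.mat) \<Rightarrow> bool" where
  "carleson d A \<longleftrightarrow> (\<exists>C :: real. \<forall>K \<in> dyadic {0..1}.
     (\<forall>i<d. \<forall>j<d. (\<lambda>Q. A Q $$ (i, j)) summable_on dyadic K) \<and>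
     mat_le d
       (complex_of_real (1 / measure lebesgue K) \<cdot>\<^sub>m
          Matrix.mat d d (\<lambda>ij. \<Sum>\<^sub>\<infinity>Q \<in> dyadic K. A Q $$ ij))
       (complex_of_real C \<cdot>\<^sub>m 1\<^sub>m d))"

definition scalar_sequence :: "nat \<Rightarrow> (real set \<Rightarrow> complex Matrix.mat) \<Rightarrow> bool" where
  "scalar_sequence d A \<longleftrightarrow> (\<exists>m :: real set \<Rightarrow> real. \<forall>Q \<in> dyadic {0..1}.
     0 \<le> m Q \<and> A Q = complex_of_real (m Q) \<cdot>\<^sub>m 1\<^sub>m d)"

text \<open>\<open>\<langle>W\<rangle>\<^sub>Q\<^sup>-\<^sup>1 \<langle>W\<^sup>1\<^sup>/\<^sup>2 f\<rangle>\<^sub>Q\<close>. The companion term \<open>\<langle>W\<^sup>-\<^sup>1\<rangle>\<^sub>Q\<^sup>-\<^sup>1 \<langle>W\<^sup>-\<^sup>1\<^sup>/\<^sup>2 g\<rangle>\<^sub>Q\<close> is the same expression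
  for the weight \<open>W\<^sup>-\<^sup>1\<close>, where \<open>W\<^sup>-\<^sup>1\<^sup>/\<^sup>2\<close> is the square root of \<open>W\<^sup>-\<^sup>1\<close>.\<close>

definition wavg :: "nat \<Rightarrow> real set \<Rightarrow> (real \<Rightarrow> complex Matrix.mat) \<Rightarrow>
    (real \<Rightarrow> complex Matrix.vec) \<Rightarrow> complex Matrix.vec" where
  "wavg d Q W f = mat_inv (avg_mat d Q W) *\<^sub>v avg_vec d Q (\<lambda>x. psd_sqrt d (W x) *\<^sub>v f x)"

text \<open>The sums of nonnegative terms below are taken in \<^typ>\<open>ennreal\<close>, so that a bound on them
  includes their convergence.\<close>

definition bilinear_bound :: "nat \<Rightarrow> (real set \<Rightarrow> complex Matrix.mat) \<Rightarrow> bool" where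
  "bilinear_bound d A \<longleftrightarrow> (\<exists>C \<ge> 0. \<forall>W f g. matrix_weight d W \<and> f \<in> L2 d \<and> g \<in> L2 d \<longrightarrow>
     (\<Sum>\<^sub>\<infinity>Q \<in> dyadic {0..1}. ennreal (cmod
        ((A Q *\<^sub>v wavg d Q W f) \<bullet>c wavg d Q (\<lambda>x. mat_inv (W x)) g)))
     \<le> ennreal (C * L2_norm f * L2_norm g))"

definition norm_bound :: "nat \<Rightarrow> (real set \<Rightarrow> complex Matrix.mat) \<Rightarrow> bool" where
  "norm_bound d A \<longleftrightarrow> (\<exists>C \<ge> 0. \<forall>W f g. matrix_weight d W \<and> f \<in> L2 d \<and> g \<in> L2 d \<longrightarrow>
     (\<Sum>\<^sub>\<infinity>Q \<in> dyadic {0..1}. ennreal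
        (cnorm (psd_sqrt d (A Q) *\<^sub>v wavg d Q W f) *
         cnorm (psd_sqrt d (A Q) *\<^sub>v wavg d Q (\<lambda>x. mat_inv (W x)) g)))
     \<le> ennreal (C * L2_norm f * L2_norm g))"

end

theory Submission
  imports Defs
begin

text \<open>Boundedness already fails on a single interval and for constant weights. If \<open>W\<close>, \<open>f\<close> and
  \<open>g\<close> are constant, then \<open>\<langle>W\<rangle>\<^sub>Q\<^sup>-\<^sup>1 \<langle>W\<^sup>1\<^sup>/\<^sup>2 f\<rangle>\<^sub>Q = W\<^sup>-\<^sup>1\<^sup>/\<^sup>2 f\<close>, and its companion for the weight \<open>W\<^sup>-\<^sup>1\<close>
  is \<open>W\<^sup>1\<^sup>/\<^sup>2 g\<close>. For \<open>A\<close> carried by the unit interval alone, with value \<open>M\<close> there, the bilinear sum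
  is the modulus of \<open>\<langle>M W\<^sup>-\<^sup>1\<^sup>/\<^sup>2 f, W\<^sup>1\<^sup>/\<^sup>2 g\<rangle>\<close>, and bounding it means bounding the norm of
  \<open>W\<^sup>1\<^sup>/\<^sup>2 M W\<^sup>-\<^sup>1\<^sup>/\<^sup>2\<close> uniformly over all positive definite \<open>W\<close>. The sum of products of norms,
  where \<open>f\<close> and \<open>g\<close> are decoupled, requires for \<open>M = 1\<close> that \<open>\<parallel>W\<^sup>-\<^sup>1\<^sup>/\<^sup>2\<parallel> \<parallel>W\<^sup>1\<^sup>/\<^sup>2\<parallel>\<close> be bounded,
  that is, that the condition number of \<open>W\<close> be bounded.

  Both uniform bounds fail in dimension two. Let \<open>W\<close> be the diagonal matrix with entries
  \<open>N\<^sup>2\<close> and \<open>1\<close>, and let \<open>f = e\<^sub>1\<close> and \<open>g = e\<^sub>0\<close> be the constant unit vectors. Then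
  \<open>W\<^sup>-\<^sup>1\<^sup>/\<^sup>2 f = e\<^sub>1\<close> and \<open>W\<^sup>1\<^sup>/\<^sup>2 g = N e\<^sub>0\<close>. With \<open>M = 1\<close> the product of the norms is \<open>N\<close>.
  In the bilinear form this choice of \<open>M\<close> gives zero, because \<open>W\<^sup>1\<^sup>/\<^sup>2\<close> and \<open>W\<^sup>-\<^sup>1\<^sup>/\<^sup>2\<close> cancel across a scalar
  matrix. A matrix \<open>M\<close> that does not commute with \<open>W\<close>, here the one with all entries \<open>1\<close>,
  couples \<open>e\<^sub>1\<close> to \<open>e\<^sub>0\<close> and gives \<open>N\<close> again.

  The Carleson condition is immediate for a sequence carried by one interval
  (\<open>carleson_at_unit_interval\<close>). What takes work is to identify the operator square roots, which are
  given by a definite description; for positive diagonal matrices this is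
  \<open>psd_sqrt_mat_diag\<close>, and it yields the weighted averages in \<open>wavg_const_mat_diag\<close>.\<close>

section \<open>Positive diagonal matrices\<close>

lemma mat_diag_mult_vec:
  fixes f :: "nat \<Rightarrow> complex"
  assumes "v \<in> carrier_vec d"
  shows "mat_diag d f *\<^sub>v v = Matrix.vec d (\<lambda>i. f i * vec_index v i)"
proof (rule eq_vecI)
  show "vec_index (mat_diag d f *\<^sub>v v) i = vec_index (Matrix.vec d (\<lambda>i. f i * vec_index v i)) i"
    if "i < dim_vec (Matrix.vec d (\<lambda>i. f i * vec_index v i))" for i
  proof -
    have i: "i < d" using that by simp
    have "vec_index (mat_diag d f *\<^sub>v v) i = (\<Sum>j\<in>{0..<d}. (if i = j then f j else 0) * vec_index v j)"
      using i assms by (simp add: mat_diag_def scalar_prod_def)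
    also have "\<dots> = (\<Sum>j\<in>{0..<d}. if i = j then f j * vec_index v j else 0)"
      by (rule sum.cong) simp_all
    also have "\<dots> = f i * vec_index v i"
      using i by simp
    finally show ?thesis using i by simp
  qed
qed (simp add: mat_diag_def)

lemma mat_diag_mult_unit_vec:
  fixes f :: "nat \<Rightarrow> complex"
  assumes "i < d"
  shows "mat_diag d f *\<^sub>v unit_vec d i = f i \<cdot>\<^sub>v unit_vec d i"
  by (rule eq_vecI) (use assms in \<open>auto simp: mat_diag_mult_vec unit_vec_def\<close>)

lemma psd_mat_diag:
  assumes "\<And>i. i < d \<Longrightarrow> 0 \<le> c i"
  shows "psd d (mat_diag d (\<lambda>i. complex_of_real (c i)))"
  unfolding psd_def
proof (intro conjI ballI)
  fix v :: "complex Matrix.vec" assume v: "v \<in> carrier_vec d"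
  have "(mat_diag d (\<lambda>i. complex_of_real (c i)) *\<^sub>v v) \<bullet>c v
      = (\<Sum>i\<in>{0..<d}. complex_of_real (c i * (cmod (vec_index v i))\<^sup>2))"
    using v by (auto simp: mat_diag_mult_vec scalar_prod_def mult.assoc complex_norm_square
        simp flip: of_real_power intro!: sum.cong)
  also have "0 \<le> \<dots>"
    by (intro sum_nonneg) (auto simp: less_eq_complex_def assms)
  finally show "0 \<le> (mat_diag d (\<lambda>i. complex_of_real (c i)) *\<^sub>v v) \<bullet>c v" .
qed simp

text \<open>This is what makes positive square roots unique. The factorization
  \<open>(B + c)(B - c) v = 0\<close> shows that \<open>w = (B - c) v\<close> satisfies \<open>B w = - c w\<close>, and a
  positive semidefinite matrix has no negative eigenvalue, so \<open>w = 0\<close>.\<close>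

lemma psd_square_eigenvector:
  assumes B: "psd d B" and v: "v \<in> carrier_vec d" and c: "0 < c"
    and eig: "(B * B) *\<^sub>v v = complex_of_real (c\<^sup>2) \<cdot>\<^sub>v v"
  shows "B *\<^sub>v v = complex_of_real c \<cdot>\<^sub>v v"
proof -
  have Bc: "B \<in> carrier_mat d d" using B by (simp add: psd_def)
  define u where "u = B *\<^sub>v v"
  define w where "w = u - complex_of_real c \<cdot>\<^sub>v v"
  have u: "u \<in> carrier_vec d" and w: "w \<in> carrier_vec d"
    using Bc v by (auto simp: u_def w_def)
  have "B *\<^sub>v w = B *\<^sub>v u - complex_of_real c \<cdot>\<^sub>v u"
    unfolding w_def using Bc v u
    by (simp add: mult_minus_distrib_mat_vec mult_mat_vec u_def)
  also have "B *\<^sub>v u = complex_of_real (c\<^sup>2) \<cdot>\<^sub>v v"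
    using eig Bc v by (simp add: u_def)
  also have "complex_of_real (c\<^sup>2) \<cdot>\<^sub>v v - complex_of_real c \<cdot>\<^sub>v u = complex_of_real (- c) \<cdot>\<^sub>v w"
    by (rule eq_vecI) (use v u in \<open>auto simp: w_def power2_eq_square algebra_simps\<close>)
  finally have "(B *\<^sub>v w) \<bullet>c w = complex_of_real (- c) * (w \<bullet>c w)"
    using w by simp
  moreover have "0 \<le> (B *\<^sub>v w) \<bullet>c w" using B w by (simp add: psd_def)
  moreover have "0 \<le> w \<bullet>c w" using w by (simp add: conjugate_square_ge_0_vec)
  ultimately have "w \<bullet>c w = 0"
    using c by (auto simp: less_eq_complex_def complex_eq_iff mult_le_0_iff)
  then have "w = 0\<^sub>v d" using w by (simp add: conjugate_square_eq_0_vec)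
  then have "vec_index (u - complex_of_real c \<cdot>\<^sub>v v) i = 0" if "i < d" for i
    using that by (simp flip: w_def)
  then have "u = complex_of_real c \<cdot>\<^sub>v v"
    using u v by (intro eq_vecI) auto
  then show ?thesis by (simp only: u_def)
qed

text \<open>Any positive semidefinite root must map each unit vector to the positive root of its
  eigenvalue, by \<open>psd_square_eigenvector\<close>; so its columns are determined.\<close>

lemma psd_sqrt_mat_diag:
  assumes c: "\<And>i. i < d \<Longrightarrow> 0 < c i"
  shows "psd_sqrt d (mat_diag d (\<lambda>i. complex_of_real ((c i)\<^sup>2)))
       = mat_diag d (\<lambda>i. complex_of_real (c i))"
  unfolding psd_sqrt_def
proof (rule the_equality)
  show "psd d (mat_diag d (\<lambda>i. complex_of_real (c i))) \<and>
      mat_diag d (\<lambda>i. complex_of_real (c i)) * mat_diag d (\<lambda>i. complex_of_real (c i))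
    = mat_diag d (\<lambda>i. complex_of_real ((c i)\<^sup>2))"
    by (intro conjI psd_mat_diag less_imp_le c) (simp_all add: power2_eq_square)
next
  fix B assume B: "psd d B \<and> B * B = mat_diag d (\<lambda>i. complex_of_real ((c i)\<^sup>2))"
  then have Bc: "B \<in> carrier_mat d d" by (simp add: psd_def)
  show "B = mat_diag d (\<lambda>i. complex_of_real (c i))"
  proof (rule eq_matI)
    fix i j assume "i < dim_row (mat_diag d (\<lambda>i. complex_of_real (c i)))"
      and "j < dim_col (mat_diag d (\<lambda>i. complex_of_real (c i)))"
    then have ij: "i < d" "j < d" by (auto simp: mat_diag_def)
    have "B *\<^sub>v unit_vec d j = complex_of_real (c j) \<cdot>\<^sub>v unit_vec d j"
      by (rule psd_square_eigenvector[of d]) (use B c[OF ij(2)] ij in \<open>simp_all add: mat_diag_mult_unit_vec\<close>)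
    then have "vec_index (B *\<^sub>v unit_vec d j) i = complex_of_real (c j) * vec_index (unit_vec d j) i"
      using ij by simp
    then show "B $$ (i, j) = mat_diag d (\<lambda>i. complex_of_real (c i)) $$ (i, j)"
      using Bc ij by (auto simp: mat_diag_def)
  qed (use Bc in \<open>auto simp: mat_diag_def\<close>)
qed

lemma mat_inv_eqI:
  assumes A: "A \<in> carrier_mat d d" and B: "B \<in> carrier_mat d d"
    and AB: "A * B = 1\<^sub>m d" and BA: "B * A = 1\<^sub>m d"
  shows "mat_inv A = B"
proof (cases "mat_inverse A")
  case None
  then show ?thesis
    using mat_inverse(1)[OF A] A B AB BA by (auto simp: Units_def ring_mat_def)
next
  case (Some C)
  then have C: "A * C = 1\<^sub>m d" "C \<in> carrier_mat d d"
    using mat_inverse(2)[OF A] by auto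
  have "B = B * (A * C)" using B C by simp
  also have "\<dots> = (B * A) * C" using A B C by (simp add: assoc_mult_mat[of _ d d _ d _ d])
  also have "\<dots> = C" using BA C by simp
  finally show ?thesis using Some by (simp add: mat_inv_def)
qed

lemma mat_diag_inverse:
  assumes "\<And>i. i < d \<Longrightarrow> f i \<noteq> (0 :: complex)"
  shows "mat_diag d f * mat_diag d (\<lambda>i. inverse (f i)) = 1\<^sub>m d"
    and "mat_diag d (\<lambda>i. inverse (f i)) * mat_diag d f = 1\<^sub>m d"
  unfolding mat_diag_diag by (rule eq_matI; use assms in \<open>auto simp: mat_diag_def\<close>)+

lemma mat_inv_mat_diag:
  assumes "\<And>i. i < d \<Longrightarrow> f i \<noteq> (0 :: complex)"
  shows "mat_inv (mat_diag d f) = mat_diag d (\<lambda>i. inverse (f i))"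
  using mat_diag_inverse[OF assms] by (intro mat_inv_eqI[of _ d]) auto

lemma mat_inv_mat_diag_square:
  assumes c: "\<And>i. i < d \<Longrightarrow> 0 < c i"
  shows "mat_inv (mat_diag d (\<lambda>i. complex_of_real ((c i)\<^sup>2)))
       = mat_diag d (\<lambda>i. complex_of_real ((1 / c i)\<^sup>2))"
proof -
  have "mat_inv (mat_diag d (\<lambda>i. complex_of_real ((c i)\<^sup>2)))
      = mat_diag d (\<lambda>i. inverse (complex_of_real ((c i)\<^sup>2)))"
    using c by (intro mat_inv_mat_diag) (auto simp: less_le)
  also have "(\<lambda>i. inverse (complex_of_real ((c i)\<^sup>2))) = (\<lambda>i. complex_of_real ((1 / c i)\<^sup>2))"
    by (simp only: inverse_eq_divide[symmetric] power_inverse of_real_inverse)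
  finally show ?thesis .
qed

section \<open>Constant weights and test functions\<close>

lemma measure_lebesgue_on_unit_interval [simp]:
  "measure (lebesgue_on {0..1::real}) {0..1} = 1"
  by (simp add: measure_restrict_space)

lemma avg_mat_const:
  assumes "M \<in> carrier_mat d d"
  shows "avg_mat d {0..1} (\<lambda>_. M) = M"
  by (rule eq_matI) (use assms in \<open>auto simp: avg_mat_def\<close>)

lemma avg_vec_const:
  assumes "v \<in> carrier_vec d"
  shows "avg_vec d {0..1} (\<lambda>_. v) = v"
  by (rule eq_vecI) (use assms in \<open>auto simp: avg_vec_def\<close>)

text \<open>Averages of constants are trivial, so this is \<open>W\<^sup>-\<^sup>1 W\<^sup>1\<^sup>/\<^sup>2 e\<^sub>i = W\<^sup>-\<^sup>1\<^sup>/\<^sup>2 e\<^sub>i\<close>. The weight is written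
  with squared entries so that its root is the matrix with entries \<open>c i\<close>. Applied to \<open>1 / c\<close>
  in place of \<open>c\<close>, it also covers the average for the inverse weight.\<close>

lemma wavg_const_mat_diag:
  assumes c: "\<And>i. i < d \<Longrightarrow> 0 < c i" and i: "i < d"
  shows "wavg d {0..1} (\<lambda>_. mat_diag d (\<lambda>i. complex_of_real ((c i)\<^sup>2))) (\<lambda>_. unit_vec d i)
       = complex_of_real (1 / c i) \<cdot>\<^sub>v unit_vec d i"
proof -
  let ?D = "mat_diag d (\<lambda>i. complex_of_real ((c i)\<^sup>2))"
  have "psd_sqrt d ?D *\<^sub>v unit_vec d i = complex_of_real (c i) \<cdot>\<^sub>v unit_vec d i"
    using c i by (simp only: psd_sqrt_mat_diag mat_diag_mult_unit_vec)
  then have "wavg d {0..1} (\<lambda>_. ?D) (\<lambda>_. unit_vec d i)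
      = mat_inv ?D *\<^sub>v (complex_of_real (c i) \<cdot>\<^sub>v unit_vec d i)"
    by (simp add: wavg_def avg_mat_const avg_vec_const)
  also have "\<dots> = complex_of_real (c i) \<cdot>\<^sub>v (complex_of_real ((1 / c i)\<^sup>2) \<cdot>\<^sub>v unit_vec d i)"
    using c i by (simp only: mat_inv_mat_diag_square mult_mat_vec[OF mat_diag_dim]
        unit_vec_carrier mat_diag_mult_unit_vec)
  also have "\<dots> = complex_of_real (c i * (1 / c i)\<^sup>2) \<cdot>\<^sub>v unit_vec d i"
    by (simp only: smult_smult_assoc of_real_mult)
  also have "c i * (1 / c i)\<^sup>2 = 1 / c i"
    using c[OF i] by (simp add: power_one_over power2_eq_square)
  finally show ?thesis .
qed

lemma matrix_weight_const_mat_diag: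
  assumes c: "\<And>i. i < d \<Longrightarrow> 0 < c i"
  shows "matrix_weight d (\<lambda>_. mat_diag d (\<lambda>i. complex_of_real ((c i)\<^sup>2)))"
proof -
  let ?D = "mat_diag d (\<lambda>i. complex_of_real ((c i)\<^sup>2))"
  let ?E = "mat_diag d (\<lambda>i. inverse (complex_of_real ((c i)\<^sup>2)))"
  have nonzero: "complex_of_real ((c i)\<^sup>2) \<noteq> 0" if "i < d" for i
    using c[OF that] by simp
  have dims: "dim_row ?D = d" "dim_col ?D = d" "dim_row ?E = d"
    by (simp_all only: mat_diag_def dim_row_mat dim_col_mat)
  have "inverts_mat ?D ?E \<and> inverts_mat ?E ?D"
    unfolding inverts_mat_def dims
    using mat_diag_inverse[where d = d and f = "\<lambda>i. complex_of_real ((c i)\<^sup>2)", OF nonzero]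
    by simp
  moreover have "square_mat ?D" by (simp only: square_mat.simps dims)
  ultimately have "invertible_mat ?D"
    unfolding invertible_mat_def by blast
  moreover have "psd d ?D" by (rule psd_mat_diag) simp
  ultimately show ?thesis
    by (simp add: matrix_weight_def)
qed

lemma cnorm_smult_unit_vec:
  assumes "i < d"
  shows "cnorm (complex_of_real t \<cdot>\<^sub>v unit_vec d i) = \<bar>t\<bar>"
  using assms by (simp add: cnorm_def flip: power2_eq_square)

lemma cnorm_unit_vec:
  assumes "i < d"
  shows "cnorm (unit_vec d i) = 1"
  using cnorm_smult_unit_vec[OF assms, of 1] by simp

lemma unit_vec_L2:
  assumes "i < d"
  shows "(\<lambda>_. unit_vec d i) \<in> L2 d" and "L2_norm (\<lambda>_. unit_vec d i) = 1"
  using assms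
  by (auto simp: L2_def L2_norm_def cnorm_unit_vec)

section \<open>Sequences carried by the unit interval\<close>

definition at_unit_interval :: "nat \<Rightarrow> complex Matrix.mat \<Rightarrow> real set \<Rightarrow> complex Matrix.mat" where
  "at_unit_interval d M Q = (if Q = {0..1} then M else 0\<^sub>m d d)"

lemma unit_interval_dyadic: "{0..1::real} \<in> dyadic {0..1}"
  by (auto simp: dyadic_def intro!: exI[of _ "0::nat"])

lemma dyadic_subset: "Q \<in> dyadic K \<Longrightarrow> Q \<subseteq> K"
  by (simp add: dyadic_def)

lemma psd_zero_mat: "psd d (0\<^sub>m d d)"
  by (auto simp: psd_def scalar_prod_def)

lemma psd_sequence_at_unit_interval:
  "psd d M \<Longrightarrow> psd_sequence d (at_unit_interval d M)"
  by (simp add: psd_sequence_def at_unit_interval_def psd_zero_mat)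

text \<open>A dyadic \<open>K\<close> has the unit interval among its dyadic subintervals only if \<open>K\<close> is that interval
  itself, so the Carleson sum over \<open>K\<close> is \<open>M\<close> for one \<open>K\<close> and \<open>0\<close> for all others. It is thus
  enough to dominate \<open>M\<close>.\<close>

lemma carleson_at_unit_interval:
  assumes M: "M \<in> carrier_mat d d" and C: "0 \<le> C"
    and le: "psd d (complex_of_real C \<cdot>\<^sub>m 1\<^sub>m d - M)"
  shows "carleson d (at_unit_interval d M)"
  unfolding carleson_def
proof (intro exI[of _ C] ballI conjI)
  fix K assume K: "K \<in> dyadic {0..1::real}"
  have hs: "((\<lambda>Q. at_unit_interval d M Q $$ (i, j)) has_sum at_unit_interval d M K $$ (i, j)) (dyadic K)"
    if "i < d" "j < d" for i j
  proof (cases "K = {0..1}")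
    case True
    then show ?thesis
      using that unit_interval_dyadic
      by (intro has_sum_finite_neutralI[of "{{0..1}}"]) (auto simp: at_unit_interval_def)
  next
    case False
    then have "{0..1} \<notin> dyadic K"
      using K by (auto dest: dyadic_subset)
    then show ?thesis
      using False that
      by (intro has_sum_finite_neutralI[of "{}"]) (auto simp: at_unit_interval_def)
  qed
  then show "\<forall>i<d. \<forall>j<d. (\<lambda>Q. at_unit_interval d M Q $$ (i, j)) summable_on dyadic K"
    by (auto simp: summable_on_def)
  have "complex_of_real (1 / measure lebesgue K) \<cdot>\<^sub>m
          Matrix.mat d d (\<lambda>ij. \<Sum>\<^sub>\<infinity>Q \<in> dyadic K. at_unit_interval d M Q $$ ij)
      = at_unit_interval d M K"
    (is "?L = _")
  proof (rule eq_matI)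
    have AK: "at_unit_interval d M K \<in> carrier_mat d d"
      using M by (simp add: at_unit_interval_def)
    fix i j assume "i < dim_row (at_unit_interval d M K)" "j < dim_col (at_unit_interval d M K)"
    then have ij: "i < d" "j < d" using AK by auto
    then have "?L $$ (i, j)
        = complex_of_real (1 / measure lebesgue K) * at_unit_interval d M K $$ (i, j)"
      using infsumI[OF hs[OF ij]] by simp
    (* The factor 1 / |K| is harmless: |K| = 1 where the entry is nonzero. *)
    then show "?L $$ (i, j) = at_unit_interval d M K $$ (i, j)"
      using ij by (cases "K = {0..1}") (simp_all add: at_unit_interval_def)
  qed (use M in \<open>simp_all add: at_unit_interval_def\<close>)
  moreover have "mat_le d (at_unit_interval d M K) (complex_of_real C \<cdot>\<^sub>m 1\<^sub>m d)"
  proof -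
    have "complex_of_real C \<cdot>\<^sub>m 1\<^sub>m d - 0\<^sub>m d d = mat_diag d (\<lambda>_. complex_of_real C)"
      by (rule eq_matI) (auto simp: mat_diag_def)
    then have "psd d (complex_of_real C \<cdot>\<^sub>m 1\<^sub>m d - 0\<^sub>m d d)"
      using C by (simp add: psd_mat_diag)
    then show ?thesis
      using M le by (simp add: mat_le_def at_unit_interval_def)
  qed
  ultimately show "mat_le d (complex_of_real (1 / measure lebesgue K) \<cdot>\<^sub>m
          Matrix.mat d d (\<lambda>ij. \<Sum>\<^sub>\<infinity>Q \<in> dyadic K. at_unit_interval d M Q $$ ij))
        (complex_of_real C \<cdot>\<^sub>m 1\<^sub>m d)"
    by simp
qed

text \<open>Lower bounds for the two sums come from the single term at the unit interval.\<close>

lemma ennreal_member_le_infsum: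
  fixes F :: "'a \<Rightarrow> ennreal"
  assumes "x \<in> S"
  shows "F x \<le> infsum F S"
proof -
  have "infsum F {x} \<le> infsum F S"
    using assms by (intro infsum_mono_neutral nonneg_summable_on_complete) auto
  then show ?thesis by simp
qed

section \<open>A constant weight of large eccentricity\<close>

text \<open>The diagonal of \<open>W\<^sup>1\<^sup>/\<^sup>2\<close>. The successor keeps the weight invertible for every \<open>n\<close>.\<close>

definition axis_length :: "nat \<Rightarrow> nat \<Rightarrow> real" where
  "axis_length n i = (if i = 0 then real (Suc n) else 1)"

definition eccentric_weight :: "nat \<Rightarrow> complex Matrix.mat" where
  "eccentric_weight n = mat_diag 2 (\<lambda>i. complex_of_real ((axis_length n i)\<^sup>2))"

lemma axis_length_pos: "0 < axis_length n i"
  by (simp add: axis_length_def)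

lemma matrix_weight_eccentric: "matrix_weight 2 (\<lambda>_. eccentric_weight n)"
  unfolding eccentric_weight_def by (rule matrix_weight_const_mat_diag) (rule axis_length_pos)

lemma wavg_eccentric:
  "wavg 2 {0..1} (\<lambda>_. eccentric_weight n) (\<lambda>_. unit_vec 2 1) = unit_vec 2 1"
proof -
  have "wavg 2 {0..1} (\<lambda>_. eccentric_weight n) (\<lambda>_. unit_vec 2 1)
      = complex_of_real (1 / axis_length n 1) \<cdot>\<^sub>v unit_vec 2 1"
    unfolding eccentric_weight_def
    by (rule wavg_const_mat_diag[where c = "axis_length n"]) (simp_all add: axis_length_pos)
  then show ?thesis by (simp add: axis_length_def)
qed

lemma wavg_inv_eccentric:
  "wavg 2 {0..1} (\<lambda>_. mat_inv (eccentric_weight n)) (\<lambda>_. unit_vec 2 0)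
   = complex_of_real (real (Suc n)) \<cdot>\<^sub>v unit_vec 2 0"
proof -
  have "mat_inv (eccentric_weight n) = mat_diag 2 (\<lambda>i. complex_of_real ((1 / axis_length n i)\<^sup>2))"
    unfolding eccentric_weight_def by (rule mat_inv_mat_diag_square) (rule axis_length_pos)
  moreover have "wavg 2 {0..1} (\<lambda>_. mat_diag 2 (\<lambda>i. complex_of_real ((1 / axis_length n i)\<^sup>2)))
      (\<lambda>_. unit_vec 2 0) = complex_of_real (1 / (1 / axis_length n 0)) \<cdot>\<^sub>v unit_vec 2 0"
    by (rule wavg_const_mat_diag[where c = "\<lambda>i. 1 / axis_length n i"]) (simp_all add: axis_length_pos)
  ultimately have "wavg 2 {0..1} (\<lambda>_. mat_inv (eccentric_weight n)) (\<lambda>_. unit_vec 2 0)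
      = complex_of_real (1 / (1 / axis_length n 0)) \<cdot>\<^sub>v unit_vec 2 0"
    by (simp only:)
  then show ?thesis by (simp add: axis_length_def)
qed

lemma ennreal_no_uniform_bound:
  assumes "\<And>n. ennreal (real (Suc n)) \<le> ennreal C"
  shows False
proof -
  obtain n where n: "C < real n" using reals_Archimedean2 by blast
  have "ennreal C < ennreal (real (Suc n))"
    using n by (intro ennreal_lessI) auto
  with assms[of n] show False by simp
qed

text \<open>The condition number is not cancelled, because the norms of \<open>W\<^sup>-\<^sup>1\<^sup>/\<^sup>2 e\<^sub>1 = e\<^sub>1\<close> and
  \<open>W\<^sup>1\<^sup>/\<^sup>2 e\<^sub>0\<close> enter separately, although the two vectors are orthogonal.\<close>

lemma not_norm_bound_identity: "\<not> norm_bound 2 (at_unit_interval 2 (1\<^sub>m 2))"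
proof
  let ?A = "at_unit_interval 2 (1\<^sub>m 2)"
  assume "norm_bound 2 ?A"
  then obtain C where C: "\<And>W f g. matrix_weight 2 W \<and> f \<in> L2 2 \<and> g \<in> L2 2 \<Longrightarrow>
     (\<Sum>\<^sub>\<infinity>Q \<in> dyadic {0..1}. ennreal
        (cnorm (psd_sqrt 2 (?A Q) *\<^sub>v wavg 2 Q W f) *
         cnorm (psd_sqrt 2 (?A Q) *\<^sub>v wavg 2 Q (\<lambda>x. mat_inv (W x)) g)))
     \<le> ennreal (C * L2_norm f * L2_norm g)"
    unfolding norm_bound_def by blast
  have sqrt: "psd_sqrt 2 (?A {0..1}) = 1\<^sub>m 2"
    using psd_sqrt_mat_diag[of 2 "\<lambda>_. 1"] by (simp add: at_unit_interval_def)
  have "ennreal (real (Suc n)) \<le> ennreal C" for n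
    using order_trans[OF ennreal_member_le_infsum[OF unit_interval_dyadic]
        C[of "\<lambda>_. eccentric_weight n" "\<lambda>_. unit_vec 2 1" "\<lambda>_. unit_vec 2 0"]]
    by (simp add: matrix_weight_eccentric unit_vec_L2 sqrt wavg_eccentric wavg_inv_eccentric
        cnorm_unit_vec cnorm_smult_unit_vec del: of_nat_Suc One_nat_def of_real_of_nat_eq)
  then show False by (rule ennreal_no_uniform_bound)
qed

text \<open>A positive multiple of the projection onto the diagonal of \<open>\<complex>\<^sup>2\<close>, in a position skew to both axes of
  the weight.\<close>

definition ones_mat :: "complex Matrix.mat" where
  "ones_mat = Matrix.mat 2 2 (\<lambda>_. 1)"

lemma psd_ones_mat: "psd 2 ones_mat"
  unfolding psd_def
proof (intro conjI ballI)
  fix v :: "complex Matrix.vec" assume v: "v \<in> carrier_vec 2"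
  define s where "s = vec_index v 0 + vec_index v 1"
  have "(ones_mat *\<^sub>v v) \<bullet>c v = s * cnj s"
    using v by (simp add: ones_mat_def scalar_prod_def numeral_2_eq_2 s_def algebra_simps)
  then show "0 \<le> (ones_mat *\<^sub>v v) \<bullet>c v"
    by (simp add: complex_mult_cnj less_eq_complex_def)
qed (simp add: ones_mat_def)

text \<open>The quadratic form of the difference is \<open>\<bar>v\<^sub>0 - v\<^sub>1\<bar>\<^sup>2\<close>, by the parallelogram law; this bounds
  the Carleson constant of \<open>ones_mat\<close> by \<open>2\<close>.\<close>

lemma psd_two_minus_ones_mat: "psd 2 (complex_of_real 2 \<cdot>\<^sub>m 1\<^sub>m 2 - ones_mat)"
  unfolding psd_def
proof (intro conjI ballI)
  fix v :: "complex Matrix.vec" assume v: "v \<in> carrier_vec 2"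
  define s where "s = vec_index v 0 - vec_index v 1"
  have "((complex_of_real 2 \<cdot>\<^sub>m 1\<^sub>m 2 - ones_mat) *\<^sub>v v) \<bullet>c v = s * cnj s"
    using v by (simp add: ones_mat_def scalar_prod_def numeral_2_eq_2 s_def algebra_simps)
  then show "0 \<le> ((complex_of_real 2 \<cdot>\<^sub>m 1\<^sub>m 2 - ones_mat) *\<^sub>v v) \<bullet>c v"
    by (simp add: complex_mult_cnj less_eq_complex_def)
qed (simp add: ones_mat_def minus_carrier_mat)

text \<open>The off-diagonal entry of \<open>ones_mat\<close> pairs \<open>W\<^sup>-\<^sup>1\<^sup>/\<^sup>2 e\<^sub>1\<close>, which the weight does not shrink, with
  \<open>W\<^sup>1\<^sup>/\<^sup>2 e\<^sub>0\<close>, which it enlarges.\<close>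

lemma not_bilinear_bound_ones: "\<not> bilinear_bound 2 (at_unit_interval 2 ones_mat)"
proof
  let ?A = "at_unit_interval 2 ones_mat"
  assume "bilinear_bound 2 ?A"
  then obtain C where C: "\<And>W f g. matrix_weight 2 W \<and> f \<in> L2 2 \<and> g \<in> L2 2 \<Longrightarrow>
     (\<Sum>\<^sub>\<infinity>Q \<in> dyadic {0..1}. ennreal (cmod
        ((?A Q *\<^sub>v wavg 2 Q W f) \<bullet>c wavg 2 Q (\<lambda>x. mat_inv (W x)) g)))
     \<le> ennreal (C * L2_norm f * L2_norm g)"
    unfolding bilinear_bound_def by blast
  have pairing: "cmod ((?A {0..1} *\<^sub>v unit_vec 2 1) \<bullet>c
      (complex_of_real (real (Suc n)) \<cdot>\<^sub>v unit_vec 2 0)) = real (Suc n)" for n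
    by (simp add: at_unit_interval_def ones_mat_def scalar_prod_def numeral_2_eq_2 norm_mult
        del: of_nat_Suc)
  have "ennreal (real (Suc n)) \<le> ennreal C" for n
    using order_trans[OF ennreal_member_le_infsum[OF unit_interval_dyadic]
        C[of "\<lambda>_. eccentric_weight n" "\<lambda>_. unit_vec 2 1" "\<lambda>_. unit_vec 2 0"]]
    by (simp add: matrix_weight_eccentric unit_vec_L2 wavg_eccentric wavg_inv_eccentric pairing
        del: of_nat_Suc One_nat_def of_real_of_nat_eq)
  then show False by (rule ennreal_no_uniform_bound)
qed

theorem theorem3p1:
  shows "\<not> (\<forall>d\<ge>1. \<forall>A. psd_sequence d A \<and> carleson d A \<longrightarrow> bilinear_bound d A) \<and>
     \<not> (\<forall>d\<ge>1. \<forall>A. psd_sequence d A \<and> carleson d A \<longrightarrow> norm_bound d A) \<and>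
     \<not> (\<forall>d\<ge>1. \<forall>A. psd_sequence d A \<and> scalar_sequence d A \<and> carleson d A
               \<longrightarrow> norm_bound d A)"
proof -
  let ?I = "at_unit_interval 2 (1\<^sub>m 2)" and ?J = "at_unit_interval 2 ones_mat"
  have J: "psd_sequence 2 ?J" "carleson 2 ?J"
    using psd_ones_mat psd_two_minus_ones_mat
    by (auto intro: psd_sequence_at_unit_interval carleson_at_unit_interval[where C = 2]
        simp: psd_def)
  have "psd 2 (1\<^sub>m 2)"
    using psd_mat_diag[of 2 "\<lambda>_. 1"] by simp
  moreover have "complex_of_real 1 \<cdot>\<^sub>m 1\<^sub>m 2 - 1\<^sub>m 2 = 0\<^sub>m 2 2"
    by (rule eq_matI) auto
  ultimately have I: "psd_sequence 2 ?I" "carleson 2 ?I"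
    using psd_zero_mat[of 2]
    by (auto intro: psd_sequence_at_unit_interval intro!: carleson_at_unit_interval[where C = 1]
        simp del: of_real_1)
  have sc: "scalar_sequence 2 ?I"
    unfolding scalar_sequence_def
    by (rule exI[of _ "\<lambda>Q. if Q = {0..1} then 1 else 0"])
      (auto simp: at_unit_interval_def intro!: eq_matI)
  have "(1::nat) \<le> 2" by simp
  (* The scalar sequence ?I also refutes the second implication. *)
  with J I sc not_bilinear_bound_ones not_norm_bound_identity show ?thesis by blast
qed

end
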